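(* Let $f$ be a non-constant rational function in $\mathbb{C}$ having no zeros in $\mathbb{C}$, and let $p\not\equiv 0$ be a polynomial. Let $k\in\mathbb{N}$ be a positive integer, let $n_0,n_1,\ldots,n_k$ be non-negative integers with $\sum_{j=0}^{k}n_j\geq 1$, and let $M[f]=\prod_{j=0}^{k}\bigl(f^{(j)}\bigr)^{n_j}$. Then $M[f]-p$ has at least $\Gamma_M$ distinct zeros in $\mathbb{C}$, where $\Gamma_M=\sum_{j=0}^{k}(j+1)n_j$.
   Context: $f^{(j)}$ denotes the $j$-th derivative of $f$, with $f^{(0)}=f$. The integer $\Gamma_M$ is called the weight of the differential monomial $M[f]$. *)

theory Defs
  imports
    "HOL-Complex_Analysis.Complex_Analysis"
    "HOL-Computational_Algebra.Computational_Algebra"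
begin

text \<open>
  A rational function is represented by its reduced fraction. As \<open>x / 0 = 0\<close>, the underlying total
  function is given the junk value 0 at the poles, which are exactly the roots of \<open>Q\<close>; this is the
  convention of \<open>nicely_meromorphic_on\<close>.
\<close>

definition rational_function :: "(complex \<Rightarrow> complex) \<Rightarrow> bool" where
  "rational_function f \<longleftrightarrow>
     (\<exists>P Q. Q \<noteq> 0 \<and> coprime P Q \<and> (\<forall>z. f z = poly P z / poly Q z))"

text \<open>
  At a pole of \<open>f\<close> the value below is unspecified, since \<open>deriv\<close> is; only notions depending on a punctured
  neighbourhood, such as \<open>isolated_zero\<close>, are meaningful there.
\<close>

definition diff_monomial ::
    "nat \<Rightarrow> (nat \<Rightarrow> nat) \<Rightarrow> (complex \<Rightarrow> complex) \<Rightarrow> complex \<Rightarrow> complex" where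
  "diff_monomial k n f = (\<lambda>z. \<Prod>j=0..k. ((deriv ^^ j) f z) ^ n j)"

definition weight :: "nat \<Rightarrow> (nat \<Rightarrow> nat) \<Rightarrow> nat" where
  "weight k n = (\<Sum>j=0..k. (j + 1) * n j)"

end

theory Submission
  imports Defs "HOL-Computational_Algebra.Field_as_Ring"
begin

text \<open>
  A rational function without zeros is \<open>c / Q\<close> with a constant \<open>c \<noteq> 0\<close>
  and a polynomial \<open>Q\<close>, which is nonconstant because \<open>f\<close> is. Let
  \<open>R\<close> be the radical of \<open>Q\<close>, and put \<open>q = degree Q\<close>,
  \<open>r = degree R\<close>, so that \<open>1 \<le> r \<le> q\<close>. Since
  \<open>Q' / Q = S / R\<close> with \<open>degree S < r\<close>, each differentiation costs one factor
  \<open>R\<close> in the denominator: the \<open>j\<close>-th derivative is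
  \<open>A / (Q * R ^ j)\<close>, where \<open>A\<close> has degree at most \<open>j * (r - 1)\<close>
  and does not vanish at the roots of \<open>Q\<close> (\<open>reduced_logarithmic_derivative\<close>,
  \<open>higher_deriv_reciprocal\<close>). With \<open>s\<close> the sum of the \<open>n j\<close> and
  \<open>t\<close> the sum of the \<open>j * n j\<close>, this gives \<open>M[f] = N / V\<close> with
  \<open>V = Q ^ s * R ^ t\<close>, \<open>degree N \<le> t * (r - 1)\<close> and \<open>N\<close>
  nonzero at the roots of \<open>Q\<close>. The weight is \<open>s + t\<close>, and the zeros of
  \<open>M[f] - p\<close> outside the poles are exactly the roots of \<open>F = N - p * V\<close>.

  The distinct roots of \<open>F\<close> are counted by the Wronskian argument behind the
  Mason--Stothers theorem. The Wronskian \<open>N' * U - N * U' = F' * U - F * U'\<close> with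
  \<open>U = p * V\<close> is nonzero, because \<open>U\<close> vanishes at the roots of
  \<open>Q\<close> and \<open>N\<close> does not. As \<open>V' / V\<close> has the form
  \<open>T / R\<close>, the Wronskian equals \<open>V / R\<close> times a polynomial \<open>G\<close>.
  The expression through \<open>F\<close> shows that \<open>G\<close> inherits every root of
  \<open>F\<close> with multiplicity lowered by at most one, so that
  \<open>degree_le_card_roots_add_degree\<close> applies, whereas the expression through
  \<open>N\<close> shows that \<open>degree G \<le> t * (r - 1) + degree p + r - 1\<close>. Therefore
  the number of distinct roots of \<open>F\<close> is at least (\<open>card_roots_ge\<close>)
  \<open>degree F - degree G \<ge> (degree p + q * s + r * t) - (t * (r - 1) + degree p + r - 1) = q * s + t - (r - 1)\<close>,
  and this is at least \<open>s + t\<close>, because \<open>(q - 1) * s \<ge> q - 1 \<ge> r - 1\<close>.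
\<close>

section \<open>Roots, multiplicities and Wronskians\<close>

lemma degree_pderiv_mult_le:
  fixes p q :: "complex poly"
  shows "degree (pderiv p * q) \<le> degree p + degree q - 1"
proof (cases "degree p = 0")
  case True
  then have "pderiv p = 0" by (simp only: pderiv_eq_0_iff)
  then show ?thesis by simp
next
  case False
  then show ?thesis using degree_mult_le[of "pderiv p" q] by (simp add: degree_pderiv)
qed

text \<open>
  A root of \<open>F\<close> of multiplicity \<open>m\<close> is a common root of \<open>F\<close> and \<open>F'\<close> of multiplicity \<open>m - 1\<close>, so all
  roots of \<open>F\<close> beyond their first occurrence are accounted for by \<open>G\<close>.
\<close>

lemma degree_le_card_roots_add_degree:
  fixes F G :: "complex poly"
  assumes "F \<noteq> 0" "G \<noteq> 0"
    and common: "\<And>D. D dvd F \<Longrightarrow> D dvd pderiv F \<Longrightarrow> D dvd G"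
  shows "degree F \<le> card {a. poly F a = 0} + degree G"
proof -
  let ?Z = "{a. poly F a = 0}"
  have fin: "finite ?Z" using assms(1) by (rule poly_roots_finite)
  have "proots F \<subseteq># mset_set ?Z + proots G"
  proof (rule mset_subset_eqI)
    fix a
    have "order a F \<le> 1 + order a G" if a: "poly F a = 0"
    proof -
      have ord: "order a F = Suc (order a (pderiv F))"
        using order_pderiv[OF assms(1) a] .
      have "[:-a, 1:] ^ order a (pderiv F) dvd pderiv F" by (rule order_1)
      moreover have "[:-a, 1:] ^ order a (pderiv F) dvd F"
        by (simp add: order_divides ord)
      ultimately have "[:-a, 1:] ^ order a (pderiv F) dvd G" by (intro common)
      then show ?thesis using assms(2) ord by (simp add: order_divides)
    qed
    then show "count (proots F) a \<le> count (mset_set ?Z + proots G) a"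
      using assms(1,2) fin by (cases "poly F a = 0") (auto simp: order_0I)
  qed
  from size_mset_mono[OF this] show ?thesis
    by (simp add: size_proots_complex)
qed

text \<open>
  If \<open>U\<close> vanishes at \<open>a\<close> to order \<open>m\<close>, then \<open>N' * U\<close> vanishes there to order at least \<open>m\<close>, but
  \<open>N * U'\<close> only to order \<open>m - 1\<close>.
\<close>

lemma wronskian_nonzero:
  fixes N U :: "complex poly"
  assumes "U \<noteq> 0" "poly U a = 0" "poly N a \<noteq> 0"
  shows "pderiv N * U - N * pderiv U \<noteq> 0"
proof
  assume "pderiv N * U - N * pderiv U = 0"
  then have eq: "N * pderiv U = pderiv N * U" by simp
  have ord: "order a U = Suc (order a (pderiv U))"
    using order_pderiv assms by blast
  have dU: "pderiv U \<noteq> 0"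
    using assms(1,2) by (auto dest!: pderiv_iszero)
  have N: "N \<noteq> 0" using assms(3) by auto
  have "[:-a, 1:] ^ order a U dvd pderiv N * U"
    using order_1 by (rule dvd_mult)
  then have "order a U \<le> order a (N * pderiv U)"
    using dU N by (simp add: eq[symmetric] order_divides)
  also have "\<dots> = order a (pderiv U)"
    using dU N assms(3) by (simp add: order_mult order_0I)
  finally show False using ord by simp
qed

text \<open>
  Dividing \<open>Q\<close> and \<open>Q'\<close> by their greatest common divisor puts the logarithmic derivative \<open>Q' / Q\<close> into
  lowest terms \<open>S / R\<close>. Its residue at a root of \<open>Q\<close> is the multiplicity \<open>m\<close> of the root, whence
  \<open>S a = m * R' a\<close> there with \<open>R' a \<noteq> 0\<close>. The last conclusion is the consequence of this that is
  needed for the successive derivatives of \<open>1 / Q\<close>.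
\<close>

lemma reduced_logarithmic_derivative:
  fixes Q :: "complex poly"
  assumes "degree Q > 0"
  obtains R S where "S * Q = R * pderiv Q" "degree S < degree R" "degree R \<le> degree Q"
    "\<forall>a. poly R a = 0 \<longleftrightarrow> poly Q a = 0"
    "\<forall>a j. poly Q a = 0 \<longrightarrow> poly (S + of_nat j * pderiv R) a \<noteq> 0"
proof -
  have Q0: "Q \<noteq> 0" and dQ: "pderiv Q \<noteq> 0" using assms by (auto simp: pderiv_eq_0_iff)
  define g where "g = gcd Q (pderiv Q)"
  obtain R where R: "Q = R * g" unfolding g_def by (metis gcd_dvd1 dvd_div_mult_self)
  obtain S where S: "pderiv Q = S * g" unfolding g_def by (metis gcd_dvd2 dvd_div_mult_self)
  obtain x y where "g = x * Q + y * pderiv Q"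
    unfolding g_def by (metis bezout_coefficients_fst_snd)
  from poly_squarefree_decomp[OF dQ R S this]
  have sqf: "rsquarefree R" and roots: "\<And>a. poly R a = 0 \<longleftrightarrow> poly Q a = 0" by auto
  have ne: "R \<noteq> 0" "g \<noteq> 0" "S \<noteq> 0" using R S Q0 dQ by auto
  have SQ: "S * Q = R * pderiv Q" using R S by (simp add: algebra_simps)
  have "degree Q = degree R + degree g" using R ne by (simp add: degree_mult_eq)
  moreover have "degree Q - 1 = degree S + degree g"
    using S ne by (metis degree_pderiv degree_mult_eq)
  ultimately have deg: "degree S < degree R" "degree R \<le> degree Q" using assms by auto
  have "poly (S + of_nat j * pderiv R) a \<noteq> 0" if a: "poly Q a = 0" for a j
  proof -
    have Ra: "poly R a = 0" using a roots by simp
    then have dRa: "poly (pderiv R) a \<noteq> 0" using sqf by (auto simp: rsquarefree_roots)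
    define m where "m = order a (pderiv Q)"
    have ordQ: "order a Q = Suc m" unfolding m_def using order_pderiv Q0 a by blast
    obtain u where u: "Q = [:-a, 1:] ^ Suc m * u" "\<not> [:-a, 1:] dvd u"
      using order_decomp[OF Q0, of a] ordQ by auto
    then have ua: "poly u a \<noteq> 0" by (simp add: poly_eq_0_iff_dvd)
    obtain v where v: "R = [:-a, 1:] * v" using Ra by (auto simp: poly_eq_0_iff_dvd elim: dvdE)
    have dRv: "poly (pderiv R) a = poly v a"
      unfolding v pderiv_mult by (simp add: pderiv_pCons)
    (* The identity S * Q = R * Q' near a; cancelling the power and evaluating at a gives S a. *)
    have "[:-a, 1:] ^ Suc m * (S * u) =
        [:-a, 1:] ^ Suc m * (v * ([:-a, 1:] * pderiv u + smult (of_nat (Suc m)) u))"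
    proof -
      have "[:-a, 1:] ^ Suc m * (S * u) = S * Q" by (simp only: u(1) mult_ac)
      also have "\<dots> = [:-a, 1:] * v *
          ([:-a, 1:] ^ Suc m * pderiv u + smult (of_nat (Suc m)) (u * [:-a, 1:] ^ m))"
        unfolding SQ v by (subst u(1), subst lemma_order_pderiv1) (rule refl)
      also have "\<dots> = [:-a, 1:] ^ Suc m * (v * ([:-a, 1:] * pderiv u + smult (of_nat (Suc m)) u))"
        by (simp only: power_Suc distrib_left mult_ac mult_smult_left mult_smult_right)
      finally show ?thesis .
    qed
    then have "S * u = v * ([:-a, 1:] * pderiv u + smult (of_nat (Suc m)) u)"
      by (simp only: mult_left_cancel power_not_zero[of "[:-a, 1:]"] pCons_eq_0_iff one_neq_zero simp_thms)
    then have "poly (S * u) a = poly (v * ([:-a, 1:] * pderiv u + smult (of_nat (Suc m)) u)) a"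
      by (rule arg_cong)
    then have "poly S a * poly u a = of_nat (Suc m) * poly (pderiv R) a * poly u a"
      by (simp add: dRv algebra_simps)
    then have "poly S a = of_nat (Suc m) * poly (pderiv R) a" using ua by simp
    then have "poly (S + of_nat j * pderiv R) a = of_nat (Suc m + j) * poly (pderiv R) a"
      by (simp add: algebra_simps poly_of_nat)
    then show ?thesis using dRa by (simp del: of_nat_Suc add: of_nat_eq_0_iff flip: of_nat_Suc)
  qed
  with SQ deg roots that show thesis by blast
qed

section \<open>The successive derivatives of a reciprocal polynomial\<close>

text \<open>
  The numerator of the \<open>j\<close>-th derivative of \<open>c / Q\<close> over the denominator \<open>Q * R ^ j\<close>, when
  \<open>Q' / Q = S / R\<close>.
\<close>

primrec deriv_numerator :: "complex \<Rightarrow> complex poly \<Rightarrow> complex poly \<Rightarrow> nat \<Rightarrow> complex poly" where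
  "deriv_numerator c R S 0 = [:c:]"
| "deriv_numerator c R S (Suc j) =
     pderiv (deriv_numerator c R S j) * R - deriv_numerator c R S j * (S + of_nat j * pderiv R)"

lemma degree_deriv_numerator_le:
  assumes "degree S < degree R"
  shows "degree (deriv_numerator c R S j) \<le> j * (degree R - 1)"
proof (induction j)
  case (Suc j)
  let ?A = "deriv_numerator c R S j"
  have "degree (pderiv ?A * R) \<le> Suc j * (degree R - 1)"
    using degree_pderiv_mult_le[of ?A R] Suc assms by simp
  moreover have "degree (of_nat j * pderiv R) \<le> degree R - 1"
    by (rule order_trans[OF degree_mult_le]) (simp add: degree_pderiv)
  then have "degree (S + of_nat j * pderiv R) \<le> degree R - 1"
    using assms by (intro degree_add_le) auto
  then have "degree (?A * (S + of_nat j * pderiv R)) \<le> Suc j * (degree R - 1)"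
    using degree_mult_le[of ?A "S + of_nat j * pderiv R"] Suc by simp
  ultimately show ?case by (simp add: degree_diff_le)
qed auto

text \<open>
  At a root of \<open>R\<close> the recursion loses its first term and just multiplies the value by
  \<open>-(S a + j * R' a)\<close>.
\<close>

lemma deriv_numerator_nonzero:
  assumes "c \<noteq> 0" "poly R a = 0" "\<And>j. poly (S + of_nat j * pderiv R) a \<noteq> 0"
  shows "poly (deriv_numerator c R S j) a \<noteq> 0"
proof (induction j)
  case (Suc j)
  then show ?case using assms(2) assms(3)[of j] by simp
qed (use assms in auto)

lemma higher_deriv_reciprocal:
  assumes SQ: "S * Q = R * pderiv Q"
    and roots: "\<forall>a. poly R a = 0 \<longleftrightarrow> poly Q a = 0"
    and f: "f = (\<lambda>z. c / poly Q z)"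
    and "poly Q z \<noteq> 0"
  shows "(deriv ^^ j) f z = poly (deriv_numerator c R S j) z / (poly Q z * poly R z ^ j)"
  using assms(4)
proof (induction j arbitrary: z)
  case 0
  then show ?case by (simp add: f)
next
  case (Suc j)
  let ?A = "deriv_numerator c R S j"
  have Qz: "poly Q z \<noteq> 0" and Rz: "poly R z \<noteq> 0" using Suc.prems roots by auto
  have "open {w. poly Q w \<noteq> 0}" by (intro open_Collect_neq continuous_intros)
  then have "\<forall>\<^sub>F w in nhds z. poly Q w \<noteq> 0"
    using Qz eventually_nhds_in_open by fastforce
  then have ev: "\<forall>\<^sub>F w in nhds z. (deriv ^^ j) f w = poly ?A w / (poly Q w * poly R w ^ j)"
    by (rule eventually_mono) (rule Suc.IH)
  have SQz: "poly (pderiv Q) z = poly S z * poly Q z / poly R z"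
    using arg_cong[OF SQ, of "\<lambda>P. poly P z"] Rz by (simp add: field_simps)
  (* Dividing by R z instead of using the exponent j - 1 keeps the formula uniform in j. *)
  have powR: "((\<lambda>w. poly R w ^ j) has_field_derivative
      of_nat j * poly R z ^ j * poly (pderiv R) z / poly R z) (at z)"
    using DERIV_power[OF poly_DERIV[of R z], of j] Rz
    by (cases j) (simp_all add: field_simps)
  (* B is the old denominator, and dB will be its derivative B * (S + j * R') / R. *)
  define B where "B = poly Q z * poly R z ^ j"
  have B: "B \<noteq> 0" using Qz Rz by (simp add: B_def)
  define dB where
    "dB = poly (pderiv Q) z * poly R z ^ j + of_nat j * poly R z ^ j * poly (pderiv R) z / poly R z * poly Q z"
  have "((\<lambda>w. poly Q w * poly R w ^ j) has_field_derivative dB) (at z)"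
    unfolding dB_def by (rule DERIV_mult[OF poly_DERIV powR])
  from DERIV_divide[OF poly_DERIV[of ?A z] this] B
  have "((\<lambda>w. poly ?A w / (poly Q w * poly R w ^ j)) has_field_derivative
      (poly (pderiv ?A) z * B - poly ?A z * dB) / (B * B)) (at z)"
    by (simp add: B_def)
  moreover have dB: "dB = B * poly (S + of_nat j * pderiv R) z / poly R z"
    using Rz by (simp add: dB_def B_def SQz field_simps)
  have "(poly (pderiv ?A) z * B - poly ?A z * dB) / (B * B) =
      poly (deriv_numerator c R S (Suc j)) z / (B * poly R z)"
    unfolding dB using B Rz by (simp add: divide_simps)
  ultimately have "((\<lambda>w. poly ?A w / (poly Q w * poly R w ^ j)) has_field_derivative
      poly (deriv_numerator c R S (Suc j)) z / (poly Q z * poly R z ^ Suc j)) (at z)"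
    by (simp add: B_def mult_ac del: deriv_numerator.simps)
  then have "deriv (\<lambda>w. poly ?A w / (poly Q w * poly R w ^ j)) z =
      poly (deriv_numerator c R S (Suc j)) z / (poly Q z * poly R z ^ Suc j)"
    by (rule DERIV_imp_deriv)
  with deriv_cong_ev[OF ev refl] show ?case by simp
qed

section \<open>Zeros of the differential monomial minus a polynomial\<close>

lemma isolated_zero_poly_quotient:
  fixes P Q :: "complex poly"
  assumes "P \<noteq> 0" "poly P a = 0" "poly Q a \<noteq> 0"
    and h: "\<And>z. poly Q z \<noteq> 0 \<Longrightarrow> h z = poly P z / poly Q z"
  shows "isolated_zero h a"
proof -
  have "open {w. poly Q w \<noteq> 0}" by (intro open_Collect_neq continuous_intros)
  then have "\<forall>\<^sub>F w in nhds a. poly Q w \<noteq> 0"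
    using assms(3) eventually_nhds_in_open by fastforce
  then have evQ: "\<forall>\<^sub>F w in at a. poly Q w \<noteq> 0"
    by (simp add: eventually_at_filter eventually_mono)
  have evP: "\<forall>\<^sub>F w in at a. poly P w \<noteq> 0"
    using islimpt_finite[OF poly_roots_finite[OF assms(1)], of a]
    by (simp add: islimpt_iff_eventually)
  have "((\<lambda>z. poly P z / poly Q z) \<longlongrightarrow> poly P a / poly Q a) (at a)"
    using assms(3) by (intro tendsto_divide) (auto simp: isCont_def[symmetric])
  then have "((\<lambda>z. poly P z / poly Q z) \<longlongrightarrow> 0) (at a)" using assms(2) by simp
  then have "h \<midarrow>a\<rightarrow> 0"
    by (rule Lim_transform_eventually) (use evQ in \<open>auto elim!: eventually_mono simp: h\<close>)
  moreover have "\<forall>\<^sub>F z in at a. h z \<noteq> 0"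
    using evQ evP by eventually_elim (simp add: h)
  ultimately show ?thesis unfolding isolated_zero_def by blast
qed

text \<open>
  In a reduced fraction a root of the numerator is no pole, hence an isolated zero of the function; so
  the numerator has no roots at all.
\<close>

lemma zero_free_rational_function:
  assumes "rational_function f" "\<not> f constant_on UNIV" "\<nexists>z. isolated_zero f z"
  obtains c Q where "c \<noteq> 0" "degree Q > 0" "f = (\<lambda>z. c / poly Q z)"
proof -
  obtain P Q where Q: "Q \<noteq> 0" "coprime P Q" and f: "\<And>z. f z = poly P z / poly Q z"
    using assms(1) unfolding rational_function_def by blast
  have P0: "P \<noteq> 0"
    using assms(2) by (auto simp: constant_on_def f)
  have "poly P a \<noteq> 0" for a
  proof
    assume "poly P a = 0"
    moreover from this have "poly Q a \<noteq> 0" using Q(2) coprime_poly_0 by blast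
    ultimately show False
      using isolated_zero_poly_quotient[OF P0, of a Q f] f assms(3) by blast
  qed
  then have "degree P = 0" using alg_closed_imp_poly_has_root[of P] by auto
  then obtain c where c: "P = [:c:]" by (rule degree_eq_zeroE)
  have "degree Q > 0"
  proof (rule ccontr)
    assume "\<not> degree Q > 0"
    then obtain d where "Q = [:d:]" using degree_eq_zeroE by blast
    with assms(2) show False by (auto simp: constant_on_def f c)
  qed
  with that[of c Q] P0 c f show thesis by (simp add: fun_eq_iff)
qed

text \<open>
  The Wronskian of \<open>N\<close> and \<open>p * V\<close>, where \<open>V = Q ^ s * R ^ t\<close>, is divided by \<open>V / R\<close> to give \<open>G\<close>. It is this
  division that brings the degree of \<open>G\<close> below that of \<open>F\<close> by at least \<open>s + t\<close>.
\<close>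

lemma card_roots_ge:
  fixes N Q R S p :: "complex poly"
  assumes SQ: "S * Q = R * pderiv Q"
    and degS: "degree S < degree R" and degR: "degree R \<le> degree Q"
    and Q: "poly Q a = 0" and N: "poly N a \<noteq> 0"
    and degN: "degree N \<le> t * (degree R - 1)"
    and p: "p \<noteq> 0" and s: "s \<ge> 1"
  defines "F \<equiv> N - p * (Q ^ s * R ^ t)"
  shows "F \<noteq> 0" and "card {z. poly F z = 0} \<ge> s + t"
proof -
  define V where "V = Q ^ s * R ^ t"
  define U where "U = p * V"
  define T where "T = of_nat s * S + of_nat t * pderiv R"
  define G where "G = R * (pderiv N * p - N * pderiv p) - N * p * T"
  have ne: "R \<noteq> 0" "Q \<noteq> 0" using degS degR by auto
  have V0: "V \<noteq> 0" and U0: "U \<noteq> 0" using ne p by (auto simp: V_def U_def)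
  have Ua: "poly U a = 0" using Q s by (simp add: U_def V_def)
  have F: "F = N - U" by (simp add: F_def U_def V_def)

  have degU: "degree U = degree p + (degree Q * s + degree R * t)"
    using ne p by (simp add: U_def V_def degree_mult_eq degree_power_eq mult.commute)
  have "t * (degree R - 1) \<le> degree R * t" by (simp add: mult.commute)
  moreover have "degree Q * s > 0" using degS degR s by simp
  ultimately have "degree N < degree U" using degN degU by linarith
  then have degF: "degree F = degree U"
    unfolding F using degree_add_eq_right[of N "- U"] by simp
  have "degree U > 0" using \<open>degree N < degree U\<close> by simp
  then show F0: "F \<noteq> 0" using degF by auto

  have RV: "R * pderiv V = V * T"
  proof -
    have powQ: "R * pderiv (Q ^ s) = Q ^ s * (of_nat s * S)"
    proof (cases s)
      case (Suc i)
      have "R * pderiv (Q ^ s) = of_nat s * Q ^ i * (R * pderiv Q)"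
        unfolding Suc pderiv_power_Suc by (simp add: of_nat_poly mult_ac)
      also have "\<dots> = Q ^ s * (of_nat s * S)"
        unfolding SQ[symmetric] Suc by (simp add: mult_ac)
      finally show ?thesis .
    qed auto
    have powR: "R * pderiv (R ^ t) = R ^ t * (of_nat t * pderiv R)"
    proof (cases t)
      case (Suc i)
      then show ?thesis unfolding Suc pderiv_power_Suc by (simp add: of_nat_poly mult_ac)
    qed auto
    have "R * pderiv V = Q ^ s * (R * pderiv (R ^ t)) + R ^ t * (R * pderiv (Q ^ s))"
      by (simp add: V_def pderiv_mult algebra_simps)
    also have "\<dots> = V * T" unfolding powQ powR by (simp add: V_def T_def algebra_simps)
    finally show ?thesis .
  qed
  have VG: "V * (R * (pderiv H * p - H * pderiv p) - H * p * T) =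
      R * (pderiv H * U - H * pderiv U)" for H
  proof -
    have "R * (pderiv H * U - H * pderiv U) =
        V * (R * (pderiv H * p - H * pderiv p)) - H * p * (R * pderiv V)"
      by (simp add: U_def pderiv_mult algebra_simps)
    then show ?thesis unfolding RV by (simp add: algebra_simps)
  qed

  have "pderiv N * U - N * pderiv U \<noteq> 0" by (rule wronskian_nonzero[OF U0 Ua N])
  then have G0: "G \<noteq> 0" using VG[of N] ne by (auto simp: G_def)

  have "pderiv N * U - N * pderiv U = pderiv F * U - F * pderiv U"
    by (simp add: F pderiv_diff algebra_simps)
  then have "V * G = V * (R * (pderiv F * p - F * pderiv p) - F * p * T)"
    unfolding G_def VG by simp
  then have "G = R * (pderiv F * p - F * pderiv p) - F * p * T" using V0 by simp
  then have "D dvd G" if "D dvd F" "D dvd pderiv F" for D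
    using that by (simp add: dvd_diff dvd_mult dvd_mult2)
  from degree_le_card_roots_add_degree[OF F0 G0 this]
  have count: "degree U \<le> card {z. poly F z = 0} + degree G" unfolding degF by blast

  have "degree (of_nat s * S) \<le> degree R - 1" "degree (of_nat t * pderiv R) \<le> degree R - 1"
    using degS by (auto intro!: order_trans[OF degree_mult_le] simp: degree_pderiv)
  then have degT: "degree T \<le> degree R - 1" unfolding T_def by (rule degree_add_le)
  (* Differentiating loses one degree in the first two terms of G, as T does against R in the third. *)
  define b where "b = degree N + degree p + (degree R - 1)"
  have "degree (R * (pderiv N * p)) \<le> b"
    using degree_pderiv_mult_le[of N "p * R"] degree_mult_le[of p R] degS
    by (simp add: b_def mult_ac)
  moreover have "degree (R * (N * pderiv p)) \<le> b"
    using degree_pderiv_mult_le[of p "N * R"] degree_mult_le[of N R] degS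
    by (simp add: b_def mult_ac)
  moreover have "degree (N * p * T) \<le> b"
    using degree_mult_le[of "N * p" T] degree_mult_le[of N p] degT by (simp add: b_def)
  ultimately have "degree G \<le> b"
    unfolding G_def right_diff_distrib by (intro degree_diff_le)
  then have degG: "degree G \<le> t * (degree R - 1) + degree p + (degree R - 1)"
    using degN by (simp add: b_def)

  obtain r where r: "degree R = Suc r" using degS by (cases "degree R") auto
  obtain q where q: "degree Q = Suc q" using degR r by (cases "degree Q") auto
  (* Here r and q are one less than the degrees of R and Q. *)
  have "r \<le> q * s" using degR r q s by (metis Suc_le_mono le_trans mult_le_mono2 mult.right_neutral)
  moreover have "degree p + (s + q * s + (t + t * r)) \<le>
      card {z. poly F z = 0} + (t * r + degree p + r)"
    using count degG unfolding degU r q by (simp add: mult.commute)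
  ultimately show "card {z. poly F z = 0} \<ge> s + t" by linarith
qed

theorem lemma6:
  fixes f :: "complex \<Rightarrow> complex" and p :: "complex poly" and k :: nat and n :: "nat \<Rightarrow> nat"
  assumes "rational_function f"
    and "\<not> f constant_on UNIV"
    and "\<nexists>z. isolated_zero f z"
    and "p \<noteq> 0"
    and "k > 0"
    and "(\<Sum>j=0..k. n j) \<ge> 1"
  shows "\<exists>Z \<subseteq> {a. isolated_zero (\<lambda>z. diff_monomial k n f z - poly p z) a}. finite Z \<and> card Z \<ge> weight k n"
proof -
  obtain c Q where c: "c \<noteq> 0" and degQ: "degree Q > 0" and f: "f = (\<lambda>z. c / poly Q z)"
    by (rule zero_free_rational_function[OF assms(1-3)])
  obtain R S where SQ: "S * Q = R * pderiv Q" and degS: "degree S < degree R"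
    and degR: "degree R \<le> degree Q" and roots: "\<forall>a. poly R a = 0 \<longleftrightarrow> poly Q a = 0"
    and res: "\<forall>a j. poly Q a = 0 \<longrightarrow> poly (S + of_nat j * pderiv R) a \<noteq> 0"
    by (rule reduced_logarithmic_derivative[OF degQ])
  define A where "A = deriv_numerator c R S"
  define s where "s = (\<Sum>j=0..k. n j)"
  define t where "t = (\<Sum>j=0..k. j * n j)"
  define N where "N = (\<Prod>j=0..k. A j ^ n j)"
  define V where "V = Q ^ s * R ^ t"
  define F where "F = N - p * V"

  have A: "poly (A j) a \<noteq> 0" if "poly Q a = 0" for a j
    unfolding A_def using c that roots res by (intro deriv_numerator_nonzero) auto
  then have N: "poly N a \<noteq> 0" if "poly Q a = 0" for a
    using that by (simp add: N_def poly_prod)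
  have "degree N \<le> (\<Sum>j=0..k. degree (A j ^ n j))"
    unfolding N_def using degree_prod_sum_le[of "{0..k}" "\<lambda>j. A j ^ n j"] by (simp add: o_def)
  also have "\<dots> \<le> (\<Sum>j=0..k. j * n j * (degree R - 1))"
  proof (rule sum_mono)
    fix j
    have "degree (A j ^ n j) \<le> degree (A j) * n j" by (rule degree_power_le)
    also have "\<dots> \<le> j * (degree R - 1) * n j"
      unfolding A_def by (intro mult_le_mono1 degree_deriv_numerator_le degS)
    finally show "degree (A j ^ n j) \<le> j * n j * (degree R - 1)" by (simp add: mult_ac)
  qed
  finally have degN: "degree N \<le> t * (degree R - 1)" by (simp add: t_def sum_distrib_right)

  obtain a where a: "poly Q a = 0" using alg_closed_imp_poly_has_root[OF degQ] by blast
  have F0: "F \<noteq> 0" and card: "card {z. poly F z = 0} \<ge> s + t"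
    unfolding F_def V_def
    using card_roots_ge[OF SQ degS degR a N[OF a] degN assms(4), of s] assms(6)
    by (simp_all add: s_def)

  have V: "poly V z \<noteq> 0 \<longleftrightarrow> poly Q z \<noteq> 0" for z
    using roots assms(6) by (auto simp: V_def s_def)
  have M: "diff_monomial k n f z - poly p z = poly F z / poly V z" if "poly V z \<noteq> 0" for z
  proof -
    have "(deriv ^^ j) f z = poly (A j) z / (poly Q z * poly R z ^ j)" for j
      unfolding A_def using that V by (intro higher_deriv_reciprocal[OF SQ roots f]) auto
    then have "diff_monomial k n f z =
        (\<Prod>j=0..k. poly (A j) z ^ n j / (poly Q z ^ n j * poly R z ^ (j * n j)))"
      by (simp add: diff_monomial_def power_divide power_mult_distrib power_mult)
    also have "\<dots> = poly N z / poly V z"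
      by (simp add: prod_dividef prod.distrib N_def V_def s_def t_def poly_prod power_sum)
    finally show ?thesis using that by (simp add: F_def field_simps)
  qed
  have "isolated_zero (\<lambda>z. diff_monomial k n f z - poly p z) b" if b: "poly F b = 0" for b
  proof -
    have "poly V b \<noteq> 0"
      using N[of b] V[of b] b by (auto simp: F_def)
    from isolated_zero_poly_quotient[OF F0 b this M] show ?thesis .
  qed
  moreover have "finite {z. poly F z = 0}" using F0 by (rule poly_roots_finite)
  moreover have "weight k n = s + t"
    by (simp add: weight_def s_def t_def sum.distrib)
  ultimately show ?thesis using card by (intro exI[of _ "{z. poly F z = 0}"]) auto
qed

end
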